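(* Let $\varphi(z)=1+B_1z+B_2z^2+\cdots$ be as in the context. If $f\in\mathcal{S}^*_s(\varphi)$ and $B_1\le\lvert B_2\rvert$, then $$T_{3,1}(f)\le 1.$$ The bound is sharp, i.e. equality holds for some $f\in\mathcal{S}^*_s(\varphi)$.
   Context: $\mathbb{D}$ is the open unit disk in $\mathbb{C}$, and $\mathcal{A}$ is the class of holomorphic functions $f$ on $\mathbb{D}$ with $f(0)=f'(0)-1=0$. The function $\varphi$ is analytic and univalent in $\mathbb{D}$ with $\varphi(0)=1$, $\operatorname{Re}\varphi(z)>0$ on $\mathbb{D}$, $\varphi(\mathbb{D})$ starlike with respect to $\varphi(0)=1$ and symmetric with respect to the real axis, and $\varphi(z)=1+B_1z+B_2z^2+\cdots$ with $B_1>0$ (so all $B_n$ are real). The symbol $\prec$ denotes subordination: $g\prec\varphi$ means $g=\varphi\circ\omega$ for some analytic $\omega:\mathbb{D}\to\mathbb{D}$ with $\omega(0)=0$. The class $\mathcal{S}^*_s(\varphi)$ consists of all $f\in\mathcal{A}$ such that $\dfrac{2zf'(z)}{f(z)-f(-z)}\prec\varphi(z)$ (the quotient being given the value $1$ at $z=0$). For $f(z)=z+a_2z^2+a_3z^3+\cdots\in\mathcal{A}$, the third order Hermitian-Toeplitz determinant is $T_{3,1}(f)=1-2\lvert a_2\rvert^2+2\operatorname{Re}(a_2^2\overline{a_3})-\lvert a_3\rvert^2$. *)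

theory Defs
  imports "HOL-Complex_Analysis.Complex_Analysis"
begin

abbreviation unit_disk :: "complex set"  (\<open>\<bbbD>\<close>)
  where "\<bbbD> \<equiv> ball 0 1"

definition taylor_coeff :: "(complex \<Rightarrow> complex) \<Rightarrow> nat \<Rightarrow> complex"
  where "taylor_coeff f n = fps_nth (fps_expansion f 0) n"

definition class_A :: "(complex \<Rightarrow> complex) set"
  where "class_A = {f. f holomorphic_on \<bbbD> \<and> f 0 = 0 \<and> deriv f 0 - 1 = 0}"

text \<open>The library predicate \<^const>\<open>starlike\<close> leaves the centre existentially quantified;
  here it is prescribed.\<close>

definition starlike_wrt :: "complex \<Rightarrow> complex set \<Rightarrow> bool"
  where "starlike_wrt a S \<longleftrightarrow> a \<in> S \<and> (\<forall>w\<in>S. closed_segment a w \<subseteq> S)"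

definition admissible :: "(complex \<Rightarrow> complex) \<Rightarrow> bool"
  where "admissible \<phi> \<longleftrightarrow>
    \<phi> holomorphic_on \<bbbD> \<and> inj_on \<phi> \<bbbD> \<and> \<phi> 0 = 1 \<and>
    (\<forall>z\<in>\<bbbD>. Re (\<phi> z) > 0) \<and>
    starlike_wrt 1 (\<phi> ` \<bbbD>) \<and>
    cnj ` (\<phi> ` \<bbbD>) = \<phi> ` \<bbbD> \<and>
    taylor_coeff \<phi> 1 \<in> \<real> \<and> Re (taylor_coeff \<phi> 1) > 0"

definition subordinate :: "(complex \<Rightarrow> complex) \<Rightarrow> (complex \<Rightarrow> complex) \<Rightarrow> bool"  (infix \<open>\<prec>\<^sub>D\<close> 50)
  where "g \<prec>\<^sub>D \<phi> \<longleftrightarrow>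
    (\<exists>\<omega>. \<omega> holomorphic_on \<bbbD> \<and> \<omega> ` \<bbbD> \<subseteq> \<bbbD> \<and> \<omega> 0 = 0 \<and> (\<forall>z\<in>\<bbbD>. g z = \<phi> (\<omega> z)))"

definition sakaguchi_quotient :: "(complex \<Rightarrow> complex) \<Rightarrow> complex \<Rightarrow> complex"
  where "sakaguchi_quotient f z =
    (if z = 0 then 1 else 2 * z * deriv f z / (f z - f (- z)))"

text \<open>The condition \<open>f z \<noteq> f (- z)\<close> says that the quotient is defined on the punctured disk;
  it has to be explicit because division by zero is total here.\<close>

definition class_Ss :: "(complex \<Rightarrow> complex) \<Rightarrow> (complex \<Rightarrow> complex) set"
  where "class_Ss \<phi> = {f \<in> class_A.
    (\<forall>z\<in>\<bbbD> - {0}. f z \<noteq> f (- z)) \<and> sakaguchi_quotient f \<prec>\<^sub>D \<phi>}"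

definition T31 :: "(complex \<Rightarrow> complex) \<Rightarrow> real"
  where "T31 f =
    (let a2 = taylor_coeff f 2; a3 = taylor_coeff f 3
     in 1 - 2 * (cmod a2)\<^sup>2 + 2 * Re (a2\<^sup>2 * cnj a3) - (cmod a3)\<^sup>2)"

end

theory Submission
  imports Defs
begin

text \<open>
  Completing the square in \<open>a\<^sub>3\<close> gives
  \<open>T\<^sub>3\<^sub>,\<^sub>1(f) = 1 - |a\<^sub>3 - a\<^sub>2\<^sup>2|\<^sup>2 - |a\<^sub>2|\<^sup>2 (2 - |a\<^sub>2|\<^sup>2)\<close>,
  so the bound \<open>T\<^sub>3\<^sub>,\<^sub>1(f) \<le> 1\<close> holds as soon as \<open>|a\<^sub>2|\<^sup>2 \<le> 2\<close>; no estimate of \<open>a\<^sub>3\<close> enters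
  (lemma \<open>T31_le_1\<close>).

  The second coefficient is bounded through the quotient
  \<open>p(z) = 2 z f'(z) / (f(z) - f(-z))\<close>. Being subordinate to a function with positive real part, \<open>p\<close>
  has positive real part itself, and \<open>p(0) = 1\<close>. Caratheodory's bound, which is the Schwarz lemma
  after a Cayley transform, yields \<open>|p'(0)| \<le> 2\<close> (lemma \<open>Caratheodory_deriv_bound\<close>). The
  denominator \<open>f(z) - f(-z)\<close> is odd, hence \<open>a\<^sub>2\<close> contributes only to the numerator and
  \<open>p'(0) = 2 a\<^sub>2\<close> (lemma \<open>deriv_eq_second_coeff\<close>). Therefore \<open>|a\<^sub>2| \<le> 1\<close>.

  Equality is attained by the identity map, for which \<open>p\<close> is constantly \<open>1 = \<phi>(0)\<close> and
  \<open>a\<^sub>2 = a\<^sub>3 = 0\<close>.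
\<close>

text \<open>The Cayley transform \<open>w \<mapsto> (w - 1) / (w + 1)\<close> carries the right half-plane to the unit disk and
  \<open>1\<close> to \<open>0\<close>, with derivative \<open>1/2\<close> there; this factor is where the \<open>2\<close> comes from.\<close>

lemma Caratheodory_deriv_bound:
  assumes hol: "p holomorphic_on \<bbbD>" and p0: "p 0 = 1"
    and pos: "\<And>z. z \<in> \<bbbD> \<Longrightarrow> Re (p z) > 0"
  shows "cmod (deriv p 0) \<le> 2"
proof -
  define h where "h = (\<lambda>z. (p z - 1) / (p z + 1))"
  have nz: "p z + 1 \<noteq> 0" if "z \<in> \<bbbD>" for z
    using pos[OF that] by (auto simp: complex_eq_iff)
  have h_hol: "h holomorphic_on \<bbbD>"
    unfolding h_def using hol nz by (intro holomorphic_intros) auto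
  have h_lt: "cmod (h z) < 1" if "cmod z < 1" for z
  proof -
    have z: "z \<in> \<bbbD>" using that by simp
    have "(cmod (p z - 1))\<^sup>2 < (cmod (p z + 1))\<^sup>2"
      using pos[OF z] unfolding cmod_power2 by (simp add: power2_eq_square algebra_simps)
    hence "cmod (p z - 1) < cmod (p z + 1)"
      by (rule power_less_imp_less_base) simp
    thus ?thesis using nz[OF z] by (simp add: h_def norm_divide divide_simps)
  qed
  have "(p has_field_derivative deriv p 0) (at 0)"
    using hol by (intro holomorphic_derivI[where S = "\<bbbD>"]) auto
  hence "(h has_field_derivative deriv p 0 / 2) (at 0)"
    unfolding h_def
    by (auto intro!: derivative_eq_intros simp: p0)
  hence "deriv h 0 = deriv p 0 / 2" by (rule DERIV_imp_deriv)
  moreover have "cmod (deriv h 0) \<le> 1"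
    by (rule Schwarz_Lemma(2)[OF h_hol _ h_lt, of 0]) (auto simp: h_def p0)
  ultimately show ?thesis by (simp only: norm_divide) simp
qed

text \<open>Compare the coefficients of \<open>z\<^sup>2\<close> in the identity \<open>p(z) (f(z) - f(-z)) = 2 z f'(z)\<close>:
  the odd function \<open>f(z) - f(-z)\<close> starts with \<open>2 z\<close> and has no quadratic term.\<close>

lemma deriv_eq_second_coeff:
  assumes f: "f \<in> class_A" and hol: "p holomorphic_on \<bbbD>"
    and eq: "\<And>z. z \<in> \<bbbD> \<Longrightarrow> p z * (f z - f (- z)) = 2 * z * deriv f z"
  shows "deriv p 0 = 2 * taylor_coeff f 2"
proof -
  define F where "F = fps_expansion f 0"
  define P where "P = fps_expansion p 0"
  have F: "f has_fps_expansion F"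
    unfolding F_def using f by (intro has_fps_expansion_fps_expansion[of "\<bbbD>"]) (auto simp: class_A_def)
  have P: "p has_fps_expansion P"
    unfolding P_def using hol by (intro has_fps_expansion_fps_expansion[of "\<bbbD>"]) auto
  have F1: "fps_nth F 1 = 1"
    using f by (simp add: F_def fps_expansion_def class_A_def)
  have P1: "fps_nth P 1 = deriv p 0"
    by (simp add: P_def fps_expansion_def)
  have "(f \<circ> (\<lambda>z. - z)) has_fps_expansion fps_compose F (- fps_X)"
    using F by (intro has_fps_expansion_compose fps_expansion_intros) auto
  hence "(\<lambda>z. p z * (f z - (f \<circ> (\<lambda>z. - z)) z)) has_fps_expansion
           P * (F - fps_compose F (- fps_X))"
    using F P by (intro fps_expansion_intros) auto
  moreover have "eventually (\<lambda>z. p z * (f z - (f \<circ> (\<lambda>z. - z)) z) = 2 * (z * deriv f z)) (nhds 0)"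
    using eq by (intro eventually_mono[OF eventually_nhds_in_open[of "\<bbbD>"]])
      (auto simp: mult.assoc)
  ultimately have "(\<lambda>z. 2 * (z * deriv f z)) has_fps_expansion P * (F - fps_compose F (- fps_X))"
    by (simp only: has_fps_expansion_cong[OF _ refl])
  moreover have "(\<lambda>z. 2 * (z * deriv f z)) has_fps_expansion fps_const 2 * (fps_X * fps_deriv F)"
    using F by (intro fps_expansion_intros)
  ultimately have
    "P * (F - fps_compose F (- fps_X)) = fps_const 2 * (fps_X * fps_deriv F)"
    by (rule fps_expansion_unique_complex)
  hence "fps_nth (P * (F - fps_compose F (- fps_X))) 2
         = fps_nth (fps_const 2 * (fps_X * fps_deriv F)) 2"
    by simp
  moreover have "fps_nth (P * (F - fps_compose F (- fps_X))) 2 = 2 * deriv p 0"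
    using F1 P1 by (simp add: fps_mult_nth fps_compose_uminus' numeral_2_eq_2)
  moreover have "fps_nth (fps_const 2 * (fps_X * fps_deriv F)) 2 = 4 * fps_nth F 2"
    by (simp add: numeral_2_eq_2)
  ultimately show ?thesis by (simp add: taylor_coeff_def F_def)
qed

text \<open>For fixed \<open>a\<^sub>2\<close> the determinant is largest at \<open>a\<^sub>3 = a\<^sub>2\<^sup>2\<close>, where it equals
  \<open>1 - |a\<^sub>2|\<^sup>2 (2 - |a\<^sub>2|\<^sup>2)\<close>.\<close>

lemma T31_le_1:
  assumes "(cmod (taylor_coeff f 2))\<^sup>2 \<le> 2"
  shows "T31 f \<le> 1"
proof -
  define a where "a = taylor_coeff f 2"
  define b where "b = taylor_coeff f 3"
  have "2 * Re (c * cnj b) - (cmod b)\<^sup>2 = (cmod c)\<^sup>2 - (cmod (c - b))\<^sup>2" for c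
    unfolding cmod_power2 by (simp add: power2_eq_square algebra_simps)
  from this[of "a\<^sup>2"]
  have square: "2 * Re (a\<^sup>2 * cnj b) - (cmod b)\<^sup>2 = ((cmod a)\<^sup>2)\<^sup>2 - (cmod (a\<^sup>2 - b))\<^sup>2"
    by (simp only: norm_power)
  have "((cmod a)\<^sup>2)\<^sup>2 \<le> 2 * (cmod a)\<^sup>2"
    unfolding power2_eq_square[of "(cmod a)\<^sup>2"]
    using assms by (intro mult_right_mono) (auto simp: a_def)
  with square show ?thesis
    using zero_le_power2[of "cmod (a\<^sup>2 - b)"]
    unfolding T31_def Let_def a_def[symmetric] b_def[symmetric] by linarith
qed

lemma second_coeff_le_1:
  assumes \<phi>: "admissible \<phi>" and f: "f \<in> class_Ss \<phi>"
  shows "cmod (taylor_coeff f 2) \<le> 1"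
proof -
  from f obtain \<omega> where \<omega>: "\<omega> holomorphic_on \<bbbD>" "\<omega> ` \<bbbD> \<subseteq> \<bbbD>" "\<omega> 0 = 0"
    and quot: "\<And>z. z \<in> \<bbbD> \<Longrightarrow> sakaguchi_quotient f z = \<phi> (\<omega> z)"
    unfolding class_Ss_def subordinate_def by blast
  have fA: "f \<in> class_A" and ne: "\<And>z. z \<in> \<bbbD> - {0} \<Longrightarrow> f z \<noteq> f (- z)"
    using f by (auto simp: class_Ss_def)
  let ?p = "\<phi> \<circ> \<omega>"
  have hol: "?p holomorphic_on \<bbbD>"
    using \<phi> \<omega> by (intro holomorphic_on_compose_gen[where t = "\<bbbD>"]) (auto simp: admissible_def)
  have eq: "?p z * (f z - f (- z)) = 2 * z * deriv f z" if "z \<in> \<bbbD>" for z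
    using quot[OF that] ne[of z] that
    by (cases "z = 0") (auto simp: sakaguchi_quotient_def field_simps)
  have "?p 0 = 1"
    using \<phi> \<omega> by (simp add: admissible_def)
  moreover have "Re (?p z) > 0" if "z \<in> \<bbbD>" for z
  proof -
    have "\<omega> z \<in> \<bbbD>" using \<omega>(2) that by blast
    thus ?thesis using \<phi> by (simp add: admissible_def)
  qed
  ultimately have "cmod (deriv ?p 0) \<le> 2"
    by (rule Caratheodory_deriv_bound[OF hol])
  thus ?thesis
    by (simp only: deriv_eq_second_coeff[OF fA hol eq] norm_mult) simp
qed

lemma ident_in_class_Ss:
  assumes "admissible \<phi>"
  shows "(\<lambda>z. z) \<in> class_Ss \<phi>"
proof -
  have "sakaguchi_quotient (\<lambda>z. z) z = \<phi> 0" for z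
    using assms by (simp add: sakaguchi_quotient_def admissible_def)
  hence "sakaguchi_quotient (\<lambda>z. z) \<prec>\<^sub>D \<phi>"
    unfolding subordinate_def by (intro exI[of _ "\<lambda>_. 0"]) auto
  thus ?thesis by (auto simp: class_Ss_def class_A_def)
qed

lemma T31_ident: "T31 (\<lambda>z. z) = 1"
proof -
  have "fps_expansion (\<lambda>z. z) 0 = fps_X"
    by (intro fps_expansion_eqI fps_expansion_intros)
  thus ?thesis by (simp add: T31_def taylor_coeff_def)
qed

theorem theorem3p1:
  fixes \<phi> :: "complex \<Rightarrow> complex"
  assumes "admissible \<phi>"
    and "Re (taylor_coeff \<phi> 1) \<le> cmod (taylor_coeff \<phi> 2)"
  shows "(\<forall>f \<in> class_Ss \<phi>. T31 f \<le> 1) \<and> (\<exists>f \<in> class_Ss \<phi>. T31 f = 1)"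
proof (intro conjI ballI)
  fix f assume "f \<in> class_Ss \<phi>"
  hence "(cmod (taylor_coeff f 2))\<^sup>2 \<le> 1"
    using second_coeff_le_1[OF assms(1)] by (simp add: power_le_one)
  thus "T31 f \<le> 1" by (intro T31_le_1) simp
next
  show "\<exists>f \<in> class_Ss \<phi>. T31 f = 1"
    using ident_in_class_Ss[OF assms(1)] T31_ident by blast
qed

end
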